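(* Every subset of $2^{\mathbb{N}}$ belonging to one of the following classes is countably perfectly meager in $2^{\mathbb{N}}$: (1) meager-additive sets, (2) $\gamma$-sets, (3) strongly meager sets, (4) Sierpiński sets.
   Context: $2^{\mathbb{N}}$ is the Cantor space with coordinatewise addition modulo $2$ as group operation and with the standard product (Haar) probability measure. A perfect set is a non-empty closed set with no isolated points. A set $A\subseteq 2^{\mathbb{N}}$ is countably perfectly meager in $2^{\mathbb{N}}$ if for every sequence $\{P_n : n\in\mathbb{N}\}$ of perfect subsets of $2^{\mathbb{N}}$ there exists an $F_\sigma$-set $F$ in $2^{\mathbb{N}}$ such that $A\subseteq F$ and $F\cap P_n$ is meager in $P_n$ for each $n$. Standard definitions, for $A\subseteq 2^{\mathbb{N}}$: $A$ is meager-additive if $A+M=\{a+m:a\in A,\ m\in M\}$ is meager for every meager $M\subseteq 2^{\mathbb{N}}$. $A$ is a $\gamma$-set if for every family $\mathcal{U}$ of open sets such that each finite subset of $A$ is contained in some member of $\mathcal{U}$, there is a sequence $(U_n)_{n\in\mathbb{N}}$ of members of $\mathcal{U}$ with $A\subseteq\bigcup_n\bigcap_{m\ge n}U_m$. $A$ is strongly meager if $A+N\neq 2^{\mathbb{N}}$ for every measure zero set $N\subseteq 2^{\mathbb{N}}$. $A$ is a Sierpiński set if $A$ is uncountable and $A\cap N$ is countable for every measure zero set $N\subseteq 2^{\mathbb{N}}$. *)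

theory Defs
  imports "HOL-Probability.Probability"
begin

text \<open>
  The Cantor space is the type \<^typ>\<open>nat \<Rightarrow> bool\<close>. Its type-class topology is the product of the
  discrete topologies on \<^typ>\<open>bool\<close>; addition modulo 2 on \<^typ>\<open>bool\<close> is exclusive or.
\<close>

type_synonym cantor = "nat \<Rightarrow> bool"

definition cantor_add :: "cantor \<Rightarrow> cantor \<Rightarrow> cantor"
  where "cantor_add x y = (\<lambda>n. x n \<noteq> y n)"

definition cantor_sumset :: "cantor set \<Rightarrow> cantor set \<Rightarrow> cantor set"
  where "cantor_sumset A B = {cantor_add a b |a b. a \<in> A \<and> b \<in> B}"

definition cantor_measure :: "cantor measure"
  where "cantor_measure = PiM UNIV (\<lambda>_. measure_pmf (bernoulli_pmf (1/2)))"

text \<open>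
  Measure zero sets need not be Borel, hence the completion.
\<close>

definition measure_zero :: "cantor set \<Rightarrow> bool"
  where "measure_zero N \<longleftrightarrow> N \<in> null_sets (completion cantor_measure)"

definition nowhere_dense_in :: "'a topology \<Rightarrow> 'a set \<Rightarrow> bool"
  where "nowhere_dense_in X S \<longleftrightarrow> S \<subseteq> topspace X \<and> X interior_of (X closure_of S) = {}"

definition meager_in :: "'a topology \<Rightarrow> 'a set \<Rightarrow> bool"
  where "meager_in X S \<longleftrightarrow> (\<exists>C :: nat \<Rightarrow> 'a set. (\<forall>n. nowhere_dense_in X (C n)) \<and> S = (\<Union>n. C n))"

definition perfect_set :: "'a :: topological_space set \<Rightarrow> bool"
  where "perfect_set P \<longleftrightarrow> P \<noteq> {} \<and> closed P \<and> (\<forall>x. \<not> x isolated_in P)"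

definition countably_perfectly_meager :: "cantor set \<Rightarrow> bool"
  where "countably_perfectly_meager A \<longleftrightarrow>
    (\<forall>P :: nat \<Rightarrow> cantor set. (\<forall>n. perfect_set (P n)) \<longrightarrow>
      (\<exists>F. fsigma_in euclidean F \<and> A \<subseteq> F \<and>
        (\<forall>n. meager_in (top_of_set (P n)) (F \<inter> P n))))"

definition meager_additive :: "cantor set \<Rightarrow> bool"
  where "meager_additive A \<longleftrightarrow>
    (\<forall>M. meager_in euclidean M \<longrightarrow> meager_in euclidean (cantor_sumset A M))"

definition gamma_set :: "cantor set \<Rightarrow> bool"
  where "gamma_set A \<longleftrightarrow>
    (\<forall>\<U>. (\<forall>U\<in>\<U>. open U) \<and> (\<forall>K. finite K \<and> K \<subseteq> A \<longrightarrow> (\<exists>U\<in>\<U>. K \<subseteq> U)) \<longrightarrow>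
      (\<exists>U :: nat \<Rightarrow> cantor set. (\<forall>n. U n \<in> \<U>) \<and> A \<subseteq> (\<Union>n. \<Inter>m\<in>{n..}. U m)))"

definition strongly_meager :: "cantor set \<Rightarrow> bool"
  where "strongly_meager A \<longleftrightarrow> (\<forall>N. measure_zero N \<longrightarrow> cantor_sumset A N \<noteq> UNIV)"

definition sierpinski_set :: "cantor set \<Rightarrow> bool"
  where "sierpinski_set A \<longleftrightarrow> uncountable A \<and> (\<forall>N. measure_zero N \<longrightarrow> countable (A \<inter> N))"

end

theory Submission
  imports Defs
begin

text \<open>
  For given perfect sets \<^term>\<open>P j\<close> the task is to cover \<^term>\<open>A\<close> by countably many
  closed sets, none of which contains a nonempty relatively open piece of any \<^term>\<open>P j\<close>; such
  a closed set meets each \<^term>\<open>P j\<close> in a nowhere dense set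
  (\<open>countably_perfectly_meagerI\<close>). The pieces to be defeated are countably many, since cylinders
  are, and each of them is infinite. Three different mechanisms supply the covering.

  \<^bold>\<open>Strongly meager and Sierpinski sets.\<close> Every set \<^term>\<open>Q\<close> with a limit point admits
  open sets \<^term>\<open>U\<close> of arbitrarily small measure with \<open>U + Q = 2\<^sup>\<nat>\<close>
  (\<open>small_open_covering_set\<close>). Assigning such sets to the pieces of the
  \<^term>\<open>P j\<close>, each piece being treated infinitely often and with summable measures, the limit
  superior of these sets is a null \<open>G\<^sub>\<delta>\<close> set \<^term>\<open>N\<close> all of whose translates are intersections of
  open sets meeting every piece. Hence the complement of any translate of \<^term>\<open>N\<close> is a countable
  union of closed sets of the required kind. A strongly meager set is disjoint from some translate of
  \<^term>\<open>N\<close>, and a Sierpinski set meets \<^term>\<open>N\<close> itself in a countable set, whose points are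
  covered one by one.

  \<^bold>\<open>Gamma-sets.\<close> Finite sets lie in clopen sets that fail to contain any prescribed finitely many
  pieces. Removing from such a clopen set a point \<^term>\<open>a l\<close> of \<^term>\<open>A\<close>, whose index
  \<^term>\<open>l\<close> records how many pieces have been dealt with, forces the sequence given by the
  gamma-property to deal with every piece infinitely often.

  \<^bold>\<open>Meager-additive sets.\<close> Let \<^term>\<open>f\<close> grow so fast that every node at level \<open>f k\<close> of the tree
  of \<open>P j\<close>, for \<open>j \<le> k\<close>, splits before level \<open>f (k + 1)\<close>. Applying
  meager-additivity to the meager set of points that vanish on only finitely many of the
  intervals \<open>[f k, f (k + 1))\<close> yields blocks of such intervals and a pattern \<open>Y n\<close> on the \<open>n\<close>-th block
  such that each \<open>a \<in> A\<close> agrees, in almost every block, with the pattern on some whole interval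
  (\<open>meager_additive_block_matching\<close>). Agreeing so from the \<open>K\<close>-th block on is a closed
  condition, and since the tree of \<open>P j\<close> splits in every interval, one can run through a block
  inside any piece of \<open>P j\<close> while disagreeing with the pattern on each interval.
\<close>

section \<open>Cylinders\<close>

definition cyl :: "cantor \<Rightarrow> nat \<Rightarrow> cantor set"
  where "cyl x n = {y. \<forall>i<n. y i = x i}"

lemma mem_cyl: "y \<in> cyl x n \<longleftrightarrow> (\<forall>i<n. y i = x i)"
  by (simp add: cyl_def)

lemma cyl_refl [simp]: "x \<in> cyl x n"
  by (simp add: cyl_def)

lemma cyl_mono: "m \<le> n \<Longrightarrow> cyl x n \<subseteq> cyl x m"
  by (auto simp: cyl_def)

lemma cyl_eq: "y \<in> cyl x n \<Longrightarrow> cyl y n = cyl x n"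
  by (auto simp: cyl_def)

lemma open_cyl: "open (cyl x n)"
proof -
  have "open {f::cantor. \<forall>i\<in>{..<n}. f (id i) \<in> {x i}}"
    by (rule product_topology_basis') (auto intro: Topological_Spaces.open_discrete)
  thus ?thesis by (simp add: cyl_def lessThan_def)
qed

lemma cyl_basis:
  assumes "open U" "x \<in> U"
  obtains n where "cyl x n \<subseteq> U"
proof -
  have "\<exists>X. x \<in> (\<Pi>\<^sub>E i\<in>UNIV. X i) \<and> (\<forall>i. openin euclidean (X i)) \<and>
          finite {i. X i \<noteq> topspace euclidean} \<and> (\<Pi>\<^sub>E i\<in>UNIV. X i) \<subseteq> U"
    using product_topology_open_contains_basis[of "\<lambda>_. euclidean" UNIV U x] assms
    by (simp add: open_fun_def)
  then obtain X :: "nat \<Rightarrow> bool set" where X: "x \<in> (\<Pi>\<^sub>E i\<in>UNIV. X i)"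
    "finite {i. X i \<noteq> UNIV}" "(\<Pi>\<^sub>E i\<in>UNIV. X i) \<subseteq> U"
    by auto
  from X(2) obtain n where n: "{i. X i \<noteq> UNIV} \<subseteq> {..<n}"
    using finite_nat_iff_bounded by blast
  have "cyl x n \<subseteq> (\<Pi>\<^sub>E i\<in>UNIV. X i)"
  proof
    fix y assume y: "y \<in> cyl x n"
    have "y i \<in> X i" for i
      using n X(1) y by (cases "i < n") (auto simp: mem_cyl PiE_def)
    thus "y \<in> (\<Pi>\<^sub>E i\<in>UNIV. X i)" by auto
  qed
  from this X(3) have "cyl x n \<subseteq> U" by (rule subset_trans)
  thus thesis by (rule that)
qed

lemma open_iff_cyl: "open U \<longleftrightarrow> (\<forall>x\<in>U. \<exists>n. cyl x n \<subseteq> U)"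
proof
  assume U: "open U"
  show "\<forall>x\<in>U. \<exists>n. cyl x n \<subseteq> U"
  proof
    fix x assume "x \<in> U"
    with U obtain n where "cyl x n \<subseteq> U" by (rule cyl_basis)
    thus "\<exists>n. cyl x n \<subseteq> U" ..
  qed
next
  assume U: "\<forall>x\<in>U. \<exists>n. cyl x n \<subseteq> U"
  show "open U"
  proof (rule Topological_Spaces.openI)
    fix x assume "x \<in> U"
    with U obtain n where "cyl x n \<subseteq> U" by auto
    thus "\<exists>T. open T \<and> x \<in> T \<and> T \<subseteq> U"
      using open_cyl cyl_refl by (intro exI[of _ "cyl x n"]) simp
  qed
qed

lemma closed_cyl: "closed (cyl x n)"
  unfolding closed_def open_iff_cyl
proof
  fix y assume "y \<in> - cyl x n"
  hence "cyl y n \<subseteq> - cyl x n" by (auto simp: mem_cyl)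
  thus "\<exists>m. cyl y m \<subseteq> - cyl x n" ..
qed

lemma closed_finite_cantor:
  fixes K :: "cantor set"
  assumes "finite K"
  shows "closed K"
proof -
  have "closed {x}" for x :: cantor
    unfolding closed_def open_iff_cyl
  proof
    fix y assume "y \<in> - {x}"
    then obtain i where "y i \<noteq> x i" by auto
    hence "cyl y (Suc i) \<subseteq> - {x}" by (auto simp: mem_cyl)
    thus "\<exists>m. cyl y m \<subseteq> - {x}" ..
  qed
  hence "closed (\<Union>x\<in>K. {x})" using assms by (intro closed_UN) auto
  thus ?thesis by simp
qed

lemma islimpt_iff_cyl: "x islimpt S \<longleftrightarrow> (\<forall>n. \<exists>y\<in>S \<inter> cyl x n. y \<noteq> x)"
proof
  assume S: "x islimpt S"
  show "\<forall>n. \<exists>y\<in>S \<inter> cyl x n. y \<noteq> x"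
  proof
    fix n
    obtain y where "y \<in> S" "y \<in> cyl x n" "y \<noteq> x"
      using S cyl_refl open_cyl by (rule islimptE)
    thus "\<exists>y\<in>S \<inter> cyl x n. y \<noteq> x" by auto
  qed
next
  assume R: "\<forall>n. \<exists>y\<in>S \<inter> cyl x n. y \<noteq> x"
  show "x islimpt S" unfolding islimpt_def
  proof (intro allI impI)
    fix T assume "x \<in> T" "open T"
    from this(2,1) obtain n where n: "cyl x n \<subseteq> T" by (rule cyl_basis)
    from R obtain y where "y \<in> S \<inter> cyl x n" "y \<noteq> x" by auto
    thus "\<exists>y\<in>S. y \<in> T \<and> y \<noteq> x" using n by auto
  qed
qed

text \<open>A finite set containing a representative of every cylinder of the given level.\<close>
definition level_points :: "nat \<Rightarrow> cantor set"
  where "level_points n = {s. \<forall>i\<ge>n. \<not> s i}"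

lemma finite_level_points: "finite (level_points n)"
proof (rule finite_subset)
  show "level_points n \<subseteq> (\<lambda>S i. i \<in> S) ` Pow {..<n}"
  proof
    fix s assume "s \<in> level_points n"
    hence "s = (\<lambda>i. i \<in> {i. s i})" "{i. s i} \<subseteq> {..<n}"
      by (auto simp: level_points_def not_less[symmetric])
    thus "s \<in> (\<lambda>S i. i \<in> S) ` Pow {..<n}" by blast
  qed
qed simp

lemma level_point_in_cyl:
  obtains s where "s \<in> level_points n" "x \<in> cyl s n"
  by (rule that[of "\<lambda>i. i < n \<and> x i"]) (auto simp: level_points_def mem_cyl)

lemma countable_cylinders: "countable {cyl x n |x n. True}"
proof (rule countable_subset)
  show "{cyl x n |x n. True} \<subseteq> (\<Union>n. (\<lambda>s. cyl s n) ` level_points n)"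
  proof
    fix c assume "c \<in> {cyl x n |x n. True}"
    then obtain x n where "c = cyl x n" by blast
    moreover obtain s where "s \<in> level_points n" "x \<in> cyl s n"
      by (rule level_point_in_cyl)
    ultimately show "c \<in> (\<Union>n. (\<lambda>s. cyl s n) ` level_points n)"
      using cyl_eq by blast
  qed
  show "countable (\<Union>n. (\<lambda>s. cyl s n) ` level_points n)"
    using finite_level_points by (auto intro: countable_finite)
qed

section \<open>A criterion for countable perfect meagerness\<close>

lemma nowhere_dense_in_subspace:
  assumes "closed C" "\<And>x k. x \<in> P \<Longrightarrow> \<not> P \<inter> cyl x k \<subseteq> C"
  shows "nowhere_dense_in (top_of_set P) (C \<inter> P)"
proof -
  have "closedin (top_of_set P) (C \<inter> P)"
    using assms(1) by (metis closedin_closed_Int inf_commute)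
  hence "top_of_set P closure_of (C \<inter> P) = C \<inter> P"
    by (rule closure_of_closedin)
  moreover have "top_of_set P interior_of (C \<inter> P) = {}"
  proof (rule ccontr)
    assume "top_of_set P interior_of (C \<inter> P) \<noteq> {}"
    then obtain y T where "openin (top_of_set P) T" "y \<in> T" "T \<subseteq> C \<inter> P"
      unfolding interior_of_def by blast
    then obtain V where V: "open V" "T = P \<inter> V" "y \<in> V" "y \<in> P"
      by (auto simp: openin_open)
    obtain k where "cyl y k \<subseteq> V" using V(1,3) by (rule cyl_basis)
    hence "P \<inter> cyl y k \<subseteq> C" using V \<open>T \<subseteq> C \<inter> P\<close> by blast
    with assms(2) V show False by blast
  qed
  ultimately show ?thesis unfolding nowhere_dense_in_def by simp
qed

lemma countably_perfectly_meagerI: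
  assumes "\<And>P :: nat \<Rightarrow> cantor set. (\<And>j. perfect_set (P j)) \<Longrightarrow>
    \<exists>\<C>. countable \<C> \<and> A \<subseteq> \<Union>\<C> \<and>
      (\<forall>C\<in>\<C>. closed C \<and> (\<forall>j. \<forall>x\<in>P j. \<forall>k. \<not> P j \<inter> cyl x k \<subseteq> C))"
  shows "countably_perfectly_meager A"
  unfolding countably_perfectly_meager_def
proof (intro allI impI)
  fix P :: "nat \<Rightarrow> cantor set"
  assume "\<forall>n. perfect_set (P n)"
  with assms obtain \<C> where \<C>: "countable \<C>" "A \<subseteq> \<Union>\<C>"
    "\<And>C. C \<in> \<C> \<Longrightarrow> closed C"
    "\<And>C j x k. C \<in> \<C> \<Longrightarrow> x \<in> P j \<Longrightarrow> \<not> P j \<inter> cyl x k \<subseteq> C"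
    by metis
  define C where "C = from_nat_into (insert {} \<C>)"
  have range: "range C = insert {} \<C>"
    unfolding C_def using \<C>(1) by (intro range_from_nat_into) auto
  have C: "closed (C m)" "\<And>j x k. x \<in> P j \<Longrightarrow> \<not> P j \<inter> cyl x k \<subseteq> C m" for m
  proof -
    have "C m \<in> insert {} \<C>" using range by blast
    thus "closed (C m)" "\<And>j x k. x \<in> P j \<Longrightarrow> \<not> P j \<inter> cyl x k \<subseteq> C m"
      using \<C>(3,4) by auto
  qed
  have "fsigma_in euclidean (\<Union>(range C))"
    using C(1) by (intro fsigma_in_Union) (auto intro: closed_imp_fsigma_in)
  moreover have "A \<subseteq> \<Union>(range C)" using \<C>(2) range by auto
  moreover have "meager_in (top_of_set (P j)) (\<Union>(range C) \<inter> P j)" for j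
    unfolding meager_in_def
    by (rule exI[of _ "\<lambda>m. C m \<inter> P j"]) (auto simp: nowhere_dense_in_subspace[OF C])
  ultimately show "\<exists>F. fsigma_in euclidean F \<and> A \<subseteq> F \<and>
      (\<forall>n. meager_in (top_of_set (P n)) (F \<inter> P n))" by blast
qed

lemma islimpt_imp_infinite_cantor:
  fixes x :: cantor
  assumes "x islimpt S"
  shows "infinite S"
proof
  assume "finite S"
  hence "open (- (S - {x}))" by (intro open_Compl closed_finite_cantor) simp
  moreover have "x \<in> - (S - {x})" by simp
  ultimately obtain n where n: "cyl x n \<subseteq> - (S - {x})" by (rule cyl_basis)
  obtain y where "y \<in> S \<inter> cyl x n" "y \<noteq> x"
    using assms unfolding islimpt_iff_cyl by auto
  thus False using n by auto
qed

lemma perfect_set_islimpt: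
  assumes "perfect_set P" "x \<in> P"
  shows "x islimpt P \<inter> cyl x k"
proof -
  have lim: "x islimpt P"
    using assms unfolding perfect_set_def isolated_in_islimpt_iff by auto
  show ?thesis unfolding islimpt_iff_cyl
  proof
    fix n
    obtain y where "y \<in> P \<inter> cyl x (max n k)" "y \<noteq> x"
      using lim unfolding islimpt_iff_cyl by auto
    thus "\<exists>y\<in>P \<inter> cyl x k \<inter> cyl x n. y \<noteq> x" by (auto simp: mem_cyl)
  qed
qed

text \<open>
  A single sequence that treats every basic piece of every \<^term>\<open>P j\<close> at arbitrarily late stages.
  The pieces inherit a limit point because perfect sets have no isolated points.
\<close>
lemma enumerate_portions:
  fixes P :: "nat \<Rightarrow> cantor set"
  assumes "\<And>j. perfect_set (P j)"
  shows "\<exists>Q :: nat \<Rightarrow> cantor set. (\<forall>i. \<exists>x. x islimpt Q i) \<and>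
    (\<forall>j. \<forall>x\<in>P j. \<forall>k n. \<exists>i\<ge>n. Q i = P j \<inter> cyl x k)"
proof -
  define \<Q> where "\<Q> = {P j \<inter> cyl x k |j x k. x \<in> P j}"
  have "\<Q> \<subseteq> (\<lambda>(j, c). P j \<inter> c) ` (UNIV \<times> {cyl x n |x n. True})"
    unfolding \<Q>_def by auto
  moreover have "countable ((\<lambda>(j, c). P j \<inter> c) ` ((UNIV::nat set) \<times> {cyl x n |x n. True}))"
    using countable_cylinders by (intro countable_image countable_SIGMA) auto
  ultimately have count: "countable \<Q>" by (rule countable_subset)
  have "P 0 \<noteq> {}" using assms unfolding perfect_set_def by blast
  hence ne: "\<Q> \<noteq> {}" unfolding \<Q>_def by blast
  define Q where "Q i = from_nat_into \<Q> (fst (prod_decode i))" for i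
  have lim: "\<exists>x. x islimpt Q i" for i
  proof -
    have "Q i \<in> \<Q>" unfolding Q_def using ne by (rule from_nat_into)
    then obtain j x k where "x \<in> P j" "Q i = P j \<inter> cyl x k" unfolding \<Q>_def by auto
    hence "x islimpt Q i" using perfect_set_islimpt[OF assms] by simp
    thus ?thesis by (rule exI[of _ x])
  qed
  have rep: "\<exists>i\<ge>n. Q i = P j \<inter> cyl x k" if "x \<in> P j" for j x k n
  proof -
    have "P j \<inter> cyl x k \<in> \<Q>" using that unfolding \<Q>_def by auto
    from from_nat_into_surj[OF count this]
    obtain l where l: "from_nat_into \<Q> l = P j \<inter> cyl x k" ..
    \<comment> \<open>Each index of the enumeration is repeated once for every second component.\<close>
    have "Q (prod_encode (l, n)) = P j \<inter> cyl x k" by (simp add: Q_def l)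
    moreover have "n \<le> prod_encode (l, n)" by (rule le_prod_encode_2)
    ultimately show ?thesis by (intro exI[of _ "prod_encode (l, n)"] conjI)
  qed
  from lim rep show ?thesis by (intro exI[of _ Q] conjI allI ballI)
qed

section \<open>Gamma-sets\<close>

text \<open>
  A gamma-set is only guaranteed to be eventually inside each member of a sequence drawn from one
  family \<open>\<U>\<close>, which could be the same member throughout. The points \<^term>\<open>a l\<close> prevent this: a
  member that has dealt only with the first \<^term>\<open>l\<close> pieces omits \<^term>\<open>a l\<close>, and therefore
  can occur only finitely often.
\<close>
lemma gamma_set_imp_countably_perfectly_meager:
  assumes "gamma_set A"
  shows "countably_perfectly_meager A"
proof (rule countably_perfectly_meagerI)
  fix P :: "nat \<Rightarrow> cantor set"
  assume P: "\<And>j. perfect_set (P j)"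
  from enumerate_portions[of P, OF P] obtain Q :: "nat \<Rightarrow> cantor set" where
    Q: "(\<forall>i. \<exists>x. x islimpt Q i) \<and> (\<forall>j. \<forall>x\<in>P j. \<forall>k n. \<exists>i\<ge>n. Q i = P j \<inter> cyl x k)" ..
  note Q = Q[THEN conjunct1, rule_format] Q[THEN conjunct2, rule_format]
  have Qinf: "infinite (Q i)" for i using Q(1)[of i] islimpt_imp_infinite_cantor by auto
  have port: "infinite (P j \<inter> cyl x k)" if "x \<in> P j" for j x k
    using Q(2)[OF that, of 0 k] Qinf by metis
  show "\<exists>\<C>. countable \<C> \<and> A \<subseteq> \<Union>\<C> \<and>
      (\<forall>C\<in>\<C>. closed C \<and> (\<forall>j. \<forall>x\<in>P j. \<forall>k. \<not> P j \<inter> cyl x k \<subseteq> C))"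
  proof (cases "finite A")
    case True
    thus ?thesis using port
      by (intro exI[of _ "{A}"]) (auto simp: closed_finite_cantor dest: finite_subset)
  next
    case False
    from infinite_countable_subset[OF this]
    obtain a :: "nat \<Rightarrow> cantor" where a: "inj a \<and> range a \<subseteq> A" ..
    note a = a[THEN conjunct1] a[THEN conjunct2]
    define good where "good l V \<longleftrightarrow> open V \<and> closed V \<and> (\<forall>i\<le>l. \<not> Q i \<subseteq> V)" for l :: nat and V
    define \<U> where "\<U> = {V - {a l} |l V. good l V}"
    have "\<forall>U\<in>\<U>. open U" unfolding \<U>_def good_def
      by (auto intro!: open_Diff closed_finite_cantor)
    moreover have "\<exists>U\<in>\<U>. K \<subseteq> U" if K: "finite K" "K \<subseteq> A" for K
    proof -
      have "finite {l. a l \<in> K}"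
        using finite_vimageI[OF K(1) a(1)] by (simp add: vimage_def)
      from ex_new_if_finite[OF infinite_UNIV_nat this] obtain l where l: "a l \<notin> K" by auto
      define q where "q i = (SOME x. x \<in> Q i - K)" for i
      have "q i \<in> Q i - K" for i
        unfolding q_def some_in_eq using Qinf[of i] K(1) finite_subset[of "Q i" K] by auto
      hence q: "\<And>i. q i \<in> Q i" "\<And>i. q i \<notin> K" by auto
      have "\<exists>n. \<forall>x\<in>K. x \<notin> cyl (q i) n" for i
      proof -
        have "open (- K)" using K(1) by (simp add: closed_finite_cantor open_Compl)
        moreover have "q i \<in> - K" using q(2) by simp
        ultimately obtain n where "cyl (q i) n \<subseteq> - K" by (rule cyl_basis)
        hence "\<forall>x\<in>K. x \<notin> cyl (q i) n" by auto
        thus ?thesis ..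
      qed
      then obtain n where n: "\<And>i x. x \<in> K \<Longrightarrow> x \<notin> cyl (q i) (n i)" by metis
      define V where "V = (\<Inter>i\<le>l. - cyl (q i) (n i))"
      have "open V" "closed V" unfolding V_def
        by (auto intro!: open_INT closed_INT open_Compl closed_Compl open_cyl closed_cyl)
      moreover have "\<not> Q i \<subseteq> V" if "i \<le> l" for i
      proof -
        have "q i \<notin> V" using that by (auto simp: V_def intro!: bexI[of _ i])
        thus ?thesis using q(1)[of i] by auto
      qed
      ultimately have "good l V" unfolding good_def by auto
      moreover have "K \<subseteq> V - {a l}" using n l unfolding V_def by auto
      ultimately show ?thesis unfolding \<U>_def by (intro bexI[of _ "V - {a l}"]) auto
    qed
    ultimately have "\<exists>U :: nat \<Rightarrow> cantor set. (\<forall>n. U n \<in> \<U>) \<and> A \<subseteq> (\<Union>n. \<Inter>m\<in>{n..}. U m)"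
      using assms[unfolded gamma_set_def, rule_format, of \<U>] by auto
    then obtain U :: "nat \<Rightarrow> cantor set" where
      U: "(\<forall>m. U m \<in> \<U>) \<and> A \<subseteq> (\<Union>n. \<Inter>m\<in>{n..}. U m)" ..
    note U = U[THEN conjunct1, rule_format] U[THEN conjunct2]
    from U(1) have "\<forall>m. \<exists>l V. U m = V - {a l} \<and> good l V" unfolding \<U>_def by auto
    then obtain l V where lV: "\<And>m. U m = V m - {a (l m)}" "\<And>m. good (l m) (V m)" by metis
    \<comment> \<open>Each \<^term>\<open>a k\<close> is eventually in \<^term>\<open>U m\<close>, so it is eventually not the removed point.\<close>
    have unbounded: "\<exists>m\<ge>n. i \<le> l m" for n i
    proof (rule ccontr)
      assume "\<not> ?thesis"
      hence small: "l m \<in> {..<i}" if "m \<ge> n" for m using that by force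
      have "\<exists>N. \<forall>m\<ge>N. l m \<noteq> k" for k
      proof -
        have "a k \<in> A" using a by blast
        with U(2) have "a k \<in> (\<Union>n. \<Inter>m\<in>{n..}. U m)" by (rule subsetD)
        then obtain N where "\<forall>m\<ge>N. a k \<in> U m" by auto
        thus ?thesis using lV(1) by (intro exI[of _ N]) auto
      qed
      then obtain N where N: "\<And>k m. m \<ge> N k \<Longrightarrow> l m \<noteq> k" by metis
      define m where "m = Max (insert n (N ` {..<i}))"
      have "n \<le> m" "\<And>k. k < i \<Longrightarrow> N k \<le> m" unfolding m_def by auto
      with small N show False by blast
    qed
    define C where "C n = (\<Inter>m\<in>{n..}. V m)" for n
    have "closed (C n)" for n using lV(2) unfolding C_def good_def by auto
    moreover have "\<not> P j \<inter> cyl x k \<subseteq> C n" if "x \<in> P j" for j x k n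
    proof -
      obtain i where i: "Q i = P j \<inter> cyl x k" using Q(2)[OF \<open>x \<in> P j\<close>, of 0 k] by auto
      obtain m where "m \<ge> n" "i \<le> l m" using unbounded by blast
      hence "\<not> Q i \<subseteq> V m" using lV(2) unfolding good_def by blast
      thus ?thesis using \<open>m \<ge> n\<close> i unfolding C_def by auto
    qed
    moreover have "A \<subseteq> \<Union>(range C)"
    proof
      fix y assume "y \<in> A"
      with U(2) have "y \<in> (\<Union>n. \<Inter>m\<in>{n..}. U m)" by (rule subsetD)
      then obtain n where "\<forall>m\<ge>n. y \<in> U m" by auto
      hence "y \<in> C n" unfolding C_def lV(1) by auto
      thus "y \<in> \<Union>(range C)" by auto
    qed
    ultimately show ?thesis by (intro exI[of _ "range C"]) auto
  qed
qed

section \<open>Haar measure\<close>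

lemma prob_space_cantor_measure: "prob_space cantor_measure"
  unfolding cantor_measure_def by (rule prob_space_PiM) (rule prob_space_measure_pmf)

lemma space_cantor_measure [simp]: "space cantor_measure = UNIV"
  unfolding cantor_measure_def by (simp add: space_PiM PiE_def extensional_def)

lemma box_in_sets_cantor_measure:
  assumes "finite J"
  shows "{x. \<forall>i\<in>J. x i \<in> X i} \<in> sets cantor_measure"
proof -
  let ?B = "\<lambda>_::nat. measure_pmf (bernoulli_pmf (1/2))"
  have "prod_emb UNIV ?B J (Pi\<^sub>E J X) \<in> sets cantor_measure"
    unfolding cantor_measure_def using assms by (intro sets_PiM_I) auto
  also have "prod_emb UNIV ?B J (Pi\<^sub>E J X) = {x. \<forall>i\<in>J. x i \<in> X i}"
    by (auto simp: prod_emb_def PiE_def Pi_def)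
  finally show ?thesis .
qed

lemma open_in_sets_cantor_measure:
  assumes "open U"
  shows "U \<in> sets cantor_measure"
proof -
  define \<B> where "\<B> = {c \<in> {cyl x n |x n. True}. c \<subseteq> U}"
  have "countable \<B>"
    unfolding \<B>_def by (rule countable_subset[OF _ countable_cylinders]) auto
  moreover have "c \<in> sets cantor_measure" if "c \<in> \<B>" for c
  proof -
    from that obtain x n where "c = cyl x n" by (auto simp: \<B>_def)
    also have "cyl x n = {y. \<forall>i\<in>{..<n}. y i \<in> {x i}}" by (auto simp: mem_cyl)
    finally show ?thesis using box_in_sets_cantor_measure[of "{..<n}" "\<lambda>i. {x i}"] by simp
  qed
  ultimately have "\<Union>\<B> \<in> sets cantor_measure" by (intro sets.countable_Union) auto
  moreover have "\<Union>\<B> = U"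
  proof
    show "U \<subseteq> \<Union>\<B>"
    proof
      fix x assume "x \<in> U"
      with assms obtain n where "cyl x n \<subseteq> U" by (rule cyl_basis)
      hence "cyl x n \<in> \<B>" by (auto simp: \<B>_def)
      thus "x \<in> \<Union>\<B>" by (rule UnionI) simp
    qed
  qed (auto simp: \<B>_def)
  ultimately show ?thesis by simp
qed

lemma cantor_add_measurable: "cantor_add d \<in> measurable cantor_measure cantor_measure"
  unfolding cantor_measure_def cantor_add_def
proof (rule measurable_PiM_single')
  fix i :: nat
  have "(\<lambda>b. d i \<noteq> b) \<in> measurable (measure_pmf (bernoulli_pmf (1/2))) (measure_pmf (bernoulli_pmf (1/2)))"
    by simp
  moreover have "(\<lambda>x. x i) \<in> measurable (PiM UNIV (\<lambda>_. measure_pmf (bernoulli_pmf (1/2)))) (measure_pmf (bernoulli_pmf (1/2)))"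
    by (rule measurable_component_singleton) simp
  ultimately show "(\<lambda>x. d i \<noteq> x i) \<in> measurable (PiM UNIV (\<lambda>_. measure_pmf (bernoulli_pmf (1/2)))) (measure_pmf (bernoulli_pmf (1/2)))"
    by (rule measurable_compose[rotated])
qed auto

lemma fair_coin_flip: "emeasure (measure_pmf (bernoulli_pmf (1/2))) {b. (c \<noteq> b) \<in> X}
    = emeasure (measure_pmf (bernoulli_pmf (1/2))) X"
proof -
  have "map_pmf (\<lambda>b. c \<noteq> b) (bernoulli_pmf (1/2)) = bernoulli_pmf (1/2)"
  proof (rule pmf_eqI)
    fix b
    have "inj (\<lambda>b. c \<noteq> b)" by (auto simp: inj_def)
    from pmf_map_inj'[OF this, of "bernoulli_pmf (1/2)" "c \<noteq> b"]
    show "pmf (map_pmf (\<lambda>b. c \<noteq> b) (bernoulli_pmf (1/2))) b = pmf (bernoulli_pmf (1/2)) b"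
      by (cases c) (simp_all add: pmf_bernoulli_half)
  qed
  hence "emeasure (measure_pmf (bernoulli_pmf (1/2))) X
      = emeasure (measure_pmf (map_pmf (\<lambda>b. c \<noteq> b) (bernoulli_pmf (1/2)))) X"
    by simp
  also have "\<dots> = emeasure (measure_pmf (bernoulli_pmf (1/2))) {b. (c \<noteq> b) \<in> X}"
    by (simp add: vimage_def)
  finally show ?thesis by simp
qed

text \<open>
  Translation invariance of the product measure: on a box, translating by \<^term>\<open>d\<close> only flips some
  of the independent fair coins.
\<close>
lemma distr_cantor_add: "distr cantor_measure cantor_measure (cantor_add d) = cantor_measure"
proof -
  let ?B = "\<lambda>_::nat. measure_pmf (bernoulli_pmf (1/2))"
  interpret product_prob_space ?B UNIV
    by unfold_locales
  show ?thesis
  proof (rule measure_eqI_PiM_infinite[where I = UNIV and M = ?B])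
    fix A :: "nat \<Rightarrow> bool set" and J :: "nat set"
    assume J: "finite J"
    have emb: "prod_emb UNIV ?B J (Pi\<^sub>E J X) = {x. \<forall>i\<in>J. x i \<in> X i}" for X :: "nat \<Rightarrow> bool set"
      by (auto simp: prod_emb_def PiE_def Pi_def)
    have ems: "emeasure cantor_measure {x. \<forall>i\<in>J. x i \<in> X i}
        = (\<Prod>i\<in>J. emeasure (measure_pmf (bernoulli_pmf (1/2))) (X i))" for X :: "nat \<Rightarrow> bool set"
      using emeasure_PiM_Collect[of J X] J by (simp add: cantor_measure_def space_PiM)
    have pre: "cantor_add d -` {x. \<forall>i\<in>J. x i \<in> A i} \<inter> space cantor_measure
        = {x. \<forall>i\<in>J. x i \<in> {b. (d i \<noteq> b) \<in> A i}}"
      by (auto simp: cantor_add_def)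
    show "emeasure (distr cantor_measure cantor_measure (cantor_add d)) (prod_emb UNIV ?B J (Pi\<^sub>E J A))
        = emeasure cantor_measure (prod_emb UNIV ?B J (Pi\<^sub>E J A))"
      unfolding emb emeasure_distr[OF cantor_add_measurable box_in_sets_cantor_measure[OF J]] pre ems fair_coin_flip ..
  next
    show "finite_measure (distr cantor_measure cantor_measure (cantor_add d))"
      by (intro prob_space.finite_measure prob_space.prob_space_distr
          prob_space_cantor_measure cantor_add_measurable)
  qed (simp_all add: cantor_measure_def)
qed

lemma measure_cantor_add:
  assumes "U \<in> sets cantor_measure"
  shows "cantor_add d -` U \<in> sets cantor_measure"
    "measure cantor_measure (cantor_add d -` U) = measure cantor_measure U"
proof -
  show "cantor_add d -` U \<in> sets cantor_measure"
    using measurable_sets[OF cantor_add_measurable assms] by simp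
  have "measure cantor_measure U = measure (distr cantor_measure cantor_measure (cantor_add d)) U"
    by (simp add: distr_cantor_add)
  also have "\<dots> = measure cantor_measure (cantor_add d -` U)"
    by (simp add: measure_distr[OF cantor_add_measurable assms])
  finally show "measure cantor_measure (cantor_add d -` U) = measure cantor_measure U" ..
qed

section \<open>Small open sets whose translates cover\<close>

text \<open>
  The continuous homomorphisms into the group of two elements; the second clause is continuity at
  the neutral element.
\<close>
definition character :: "(cantor \<Rightarrow> bool) \<Rightarrow> bool"
  where "character \<phi> \<longleftrightarrow> (\<forall>x y. \<phi> (cantor_add x y) \<longleftrightarrow> \<phi> x \<noteq> \<phi> y) \<and>
    (\<exists>n. \<forall>x. (\<forall>i<n. \<not> x i) \<longrightarrow> \<not> \<phi> x)"

lemma character_cantor_add: "character \<phi> \<Longrightarrow> \<phi> (cantor_add x y) \<longleftrightarrow> \<phi> x \<noteq> \<phi> y"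
  by (simp add: character_def)

lemma character_trivial: "character (\<lambda>_. False)"
  by (simp add: character_def)

lemma character_add_coordinate:
  assumes "character \<phi>"
  shows "character (\<lambda>x. \<phi> x \<noteq> x k)"
proof -
  from assms obtain n where n: "\<forall>x. (\<forall>i<n. \<not> x i) \<longrightarrow> \<not> \<phi> x"
    unfolding character_def by auto
  have "\<forall>x. (\<forall>i<max n (Suc k). \<not> x i) \<longrightarrow> \<not> (\<phi> x \<noteq> x k)" using n by auto
  moreover have "\<forall>x y. (\<phi> (cantor_add x y) \<noteq> cantor_add x y k) \<longleftrightarrow> (\<phi> x \<noteq> x k) \<noteq> (\<phi> y \<noteq> y k)"
    using assms by (auto simp: character_cantor_add) (auto simp: cantor_add_def)
  ultimately show ?thesis
    unfolding character_def by (intro conjI exI[of _ "max n (Suc k)"])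
qed

lemma open_character_kernel:
  assumes "character \<phi>"
  shows "open {x. \<not> \<phi> x}"
  unfolding open_iff_cyl
proof
  fix x assume x: "x \<in> {x. \<not> \<phi> x}"
  from assms obtain n where n: "\<forall>x. (\<forall>i<n. \<not> x i) \<longrightarrow> \<not> \<phi> x"
    unfolding character_def by auto
  have "\<not> \<phi> y" if y: "y \<in> cyl x n" for y
  proof -
    have "\<not> \<phi> (cantor_add y x)" using n y by (auto simp: mem_cyl cantor_add_def)
    thus ?thesis using x assms by (simp add: character_cantor_add)
  qed
  thus "\<exists>n. cyl x n \<subseteq> {x. \<not> \<phi> x}" by (intro exI[of _ n]) auto
qed

text \<open>
  Points \<^term>\<open>q s\<close> of \<^term>\<open>Q\<close> close to \<^term>\<open>x\<close> can be chosen so that the differences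
  \<open>q s + x\<close> are linearly independent over the field of two elements, hence characters take any
  prescribed values on them. The induction keeps the new points inside a cylinder beyond a coordinate
  \<^term>\<open>n\<close> at which the previous point \<^term>\<open>p\<close> differs from \<^term>\<open>x\<close>, so that adding
  this coordinate to a character corrects its value at \<open>p + x\<close> and changes no other one.
\<close>
lemma interpolating_characters:
  assumes "x islimpt Q" "finite I"
  shows "\<exists>q. (\<forall>s\<in>I. q s \<in> Q \<inter> cyl x N) \<and>
    (\<forall>h. \<exists>\<phi>. character \<phi> \<and> (\<forall>s\<in>I. \<phi> (cantor_add (q s) x) = h s))"
  using assms(2)
proof (induction I arbitrary: N rule: finite_induct)
  case empty
  show ?case using character_trivial by auto
next
  case (insert t I)
  obtain p where p: "p \<in> Q" "p \<in> cyl x N" "p \<noteq> x"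
    using assms(1) unfolding islimpt_iff_cyl by auto
  then obtain n where n: "p n \<noteq> x n" by auto
  have "N \<le> n" using p(2) n by (auto simp: mem_cyl not_less[symmetric])
  from insert.IH[of "Suc n"] obtain q where
    q: "(\<forall>s\<in>I. q s \<in> Q \<inter> cyl x (Suc n)) \<and>
      (\<forall>h. \<exists>\<phi>. character \<phi> \<and> (\<forall>s\<in>I. \<phi> (cantor_add (q s) x) = h s))" ..
  note \<phi> = q[THEN conjunct2, rule_format] and q = q[THEN conjunct1]
  define q' where "q' = q(t := p)"
  have q'I: "q' s = q s" if "s \<in> I" for s using that insert.hyps by (auto simp: q'_def)
  have q't: "q' t = p" by (simp add: q'_def)
  have "\<forall>s\<in>insert t I. q' s \<in> Q \<inter> cyl x N"
    using q p q'I q't \<open>N \<le> n\<close> by (auto simp: mem_cyl)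
  moreover have "\<exists>\<phi>. character \<phi> \<and> (\<forall>s\<in>insert t I. \<phi> (cantor_add (q' s) x) = h s)" for h
  proof -
    from \<phi>[of h] obtain \<phi> where
      c: "character \<phi> \<and> (\<forall>s\<in>I. \<phi> (cantor_add (q s) x) = h s)" ..
    note c = c[THEN conjunct1] c[THEN conjunct2]
    show ?thesis
    proof (cases "\<phi> (cantor_add p x) = h t")
      case True
      thus ?thesis using c q'I q't by (intro exI[of _ \<phi>]) auto
    next
      case False
      have "(\<phi> (cantor_add p x) \<noteq> cantor_add p x n) = h t"
        using False n by (auto simp: cantor_add_def)
      moreover have "\<not> cantor_add (q s) x n" if "s \<in> I" for s
        using q that by (auto simp: cantor_add_def mem_cyl)
      ultimately show ?thesis using c q'I q't character_add_coordinate[OF c(1), of n]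
        by (intro exI[of _ "\<lambda>y. \<phi> y \<noteq> y n"]) auto
    qed
  qed
  ultimately show ?case by (intro exI[of _ q'] conjI allI)
qed

text \<open>
  Index \<open>2 ^ r\<close> points of \<^term>\<open>Q\<close> by the subsets of \<open>{..<r}\<close> and choose characters
  \<open>\<phi> b\<close> that read off the index. The common kernel \<^term>\<open>U\<close> of \<open>\<phi> 0, \<dots>, \<phi> (r - 1)\<close> then
  tiles the space: its translates by the \<open>2 ^ r\<close> points are pairwise disjoint, which bounds its measure, and
  they cover everything, since an element is in the translate whose index its own values spell out.
\<close>
lemma small_open_covering_set:
  assumes "x islimpt Q"
  shows "\<exists>U. open U \<and> measure cantor_measure U \<le> 1 / 2 ^ r \<and>
    (\<forall>y. \<exists>q\<in>Q. cantor_add y q \<in> U)"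
proof -
  interpret prob_space cantor_measure by (rule prob_space_cantor_measure)
  have "finite (Pow {..<r})" by simp
  from interpolating_characters[OF assms this, of 0] obtain q where
    q: "(\<forall>S\<in>Pow {..<r}. q S \<in> Q \<inter> cyl x 0) \<and>
      (\<forall>h. \<exists>\<phi>. character \<phi> \<and> (\<forall>S\<in>Pow {..<r}. \<phi> (cantor_add (q S) x) = h S))" ..
  note ex = q[THEN conjunct2, rule_format] and q = q[THEN conjunct1]
  have "\<forall>b. \<exists>\<phi>. character \<phi> \<and> (\<forall>S\<in>Pow {..<r}. \<phi> (cantor_add (q S) x) = (b \<in> S))"
    by (rule allI) (rule ex[of "\<lambda>S. _ \<in> S"])
  from choice[OF this] obtain \<phi> where
    "\<forall>b. character (\<phi> b) \<and> (\<forall>S\<in>Pow {..<r}. \<phi> b (cantor_add (q S) x) = (b \<in> S))" ..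
  hence c: "\<And>b. character (\<phi> b)"
    and \<phi>: "\<And>b S. S \<subseteq> {..<r} \<Longrightarrow> \<phi> b (cantor_add (q S) x) = (b \<in> S)" by auto
  define U where "U = (\<Inter>b<r. {y. \<not> \<phi> b y})"
  define T where "T S = cantor_add (cantor_add (q S) x) -` U" for S
  have "open U" unfolding U_def using c by (intro open_INT) (auto intro: open_character_kernel)
  hence U: "U \<in> sets cantor_measure" by (rule open_in_sets_cantor_measure)
  have T: "y \<in> T S \<longleftrightarrow> (\<forall>b<r. \<phi> b y = (b \<in> S))" if "S \<subseteq> {..<r}" for y S
  proof -
    have "\<phi> b (cantor_add (cantor_add (q S) x) y) \<longleftrightarrow> (b \<in> S) \<noteq> \<phi> b y" for b
      by (subst character_cantor_add[OF c]) (simp add: \<phi>[OF that])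
    thus ?thesis unfolding T_def U_def by auto
  qed
  have T_sets: "T S \<in> sets cantor_measure"
    and T_measure: "measure cantor_measure (T S) = measure cantor_measure U" for S
    unfolding T_def by (simp_all add: measure_cantor_add[OF U])
  have "disjoint_family_on T (Pow {..<r})"
    unfolding disjoint_family_on_def
  proof (intro ballI impI)
    fix S S' assume S: "S \<in> Pow {..<r}" "S' \<in> Pow {..<r}" "S \<noteq> S'"
    show "T S \<inter> T S' = {}"
    proof (rule ccontr)
      assume "T S \<inter> T S' \<noteq> {}"
      then obtain y where "y \<in> T S" "y \<in> T S'" by auto
      hence "\<forall>b<r. (b \<in> S) = (b \<in> S')" using S T by auto
      hence "S = S'" using S by auto
      thus False using S by simp
    qed
  qed
  hence "measure cantor_measure (\<Union>S\<in>Pow {..<r}. T S) = (\<Sum>S\<in>Pow {..<r}. measure cantor_measure (T S))"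
    using T_sets by (intro finite_measure_finite_Union) auto
  also have "\<dots> = (\<Sum>S\<in>Pow {..<r}. measure cantor_measure U)"
    by (simp add: T_measure)
  also have "\<dots> = 2 ^ r * measure cantor_measure U" by (simp add: card_Pow)
  finally have "2 ^ r * measure cantor_measure U \<le> 1"
    using prob_le_1[of "\<Union>S\<in>Pow {..<r}. T S"] by simp
  hence "measure cantor_measure U \<le> 1 / 2 ^ r" by (simp add: field_simps)
  moreover have "\<exists>p\<in>Q. cantor_add y p \<in> U" for y
  proof -
    define S where "S = {b. b < r \<and> \<phi> b (cantor_add y x)}"
    have S: "S \<subseteq> {..<r}" by (auto simp: S_def)
    have "cantor_add y (q S) = cantor_add (cantor_add y x) (cantor_add (q S) x)"
      by (auto simp: cantor_add_def fun_eq_iff)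
    hence "\<phi> b (cantor_add y (q S)) \<longleftrightarrow> \<phi> b (cantor_add y x) \<noteq> (b \<in> S)" for b
      by (metis character_cantor_add[OF c] \<phi>[OF S])
    hence "cantor_add y (q S) \<in> U" unfolding U_def S_def by auto
    thus ?thesis using q S by (intro bexI[of _ "q S"]) auto
  qed
  ultimately show ?thesis using \<open>open U\<close> by (intro exI[of _ U] conjI allI)
qed

section \<open>Strongly meager sets and Sierpinski sets\<close>

lemma open_translate:
  assumes "open U"
  shows "open {y. cantor_add y t \<in> U}"
  unfolding open_iff_cyl
proof
  fix y assume "y \<in> {y. cantor_add y t \<in> U}"
  hence "cantor_add y t \<in> U" by simp
  with assms obtain n where n: "cyl (cantor_add y t) n \<subseteq> U" by (rule cyl_basis)
  have "cyl y n \<subseteq> {y. cantor_add y t \<in> U}"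
  proof
    fix z assume "z \<in> cyl y n"
    hence "cantor_add z t \<in> cyl (cantor_add y t) n" by (auto simp: mem_cyl cantor_add_def)
    with n have "cantor_add z t \<in> U" by (rule subsetD)
    thus "z \<in> {y. cantor_add y t \<in> U}" by simp
  qed
  thus "\<exists>n. cyl y n \<subseteq> {y. cantor_add y t \<in> U}" by (rule exI[of _ n])
qed

text \<open>
  The limit superior of small sets \<^term>\<open>U i\<close> with \<open>U i + Q i = 2\<^sup>\<nat>\<close> is null by the Borel-Cantelli
  lemma. That \<open>U i + Q i\<close> contains \<^term>\<open>t\<close> says that the translate of \<^term>\<open>U i\<close> by
  \<^term>\<open>t\<close> meets \<^term>\<open>Q i\<close>, which is why the conclusion holds for all translates at once.
\<close>
lemma translates_dense_null_gdelta:
  fixes P :: "nat \<Rightarrow> cantor set"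
  assumes "\<And>j. perfect_set (P j)"
  shows "\<exists>G :: nat \<Rightarrow> cantor set. (\<forall>n. open (G n)) \<and> measure_zero (\<Inter>n. G n) \<and>
    (\<forall>n t j. \<forall>x\<in>P j. \<forall>k. \<exists>z\<in>P j \<inter> cyl x k. cantor_add z t \<in> G n)"
proof -
  interpret prob_space cantor_measure by (rule prob_space_cantor_measure)
  from enumerate_portions[of P, OF assms] obtain Q :: "nat \<Rightarrow> cantor set" where
    Q: "(\<forall>i. \<exists>x. x islimpt Q i) \<and> (\<forall>j. \<forall>x\<in>P j. \<forall>k n. \<exists>i\<ge>n. Q i = P j \<inter> cyl x k)" ..
  note Q = Q[THEN conjunct1, rule_format] Q[THEN conjunct2, rule_format]
  have "\<forall>i. \<exists>U. open U \<and> measure cantor_measure U \<le> 1 / 2 ^ i \<and>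
      (\<forall>y. \<exists>q\<in>Q i. cantor_add y q \<in> U)"
  proof
    fix i
    from Q(1)[of i] obtain x where "x islimpt Q i" ..
    thus "\<exists>U. open U \<and> measure cantor_measure U \<le> 1 / 2 ^ i \<and>
      (\<forall>y. \<exists>q\<in>Q i. cantor_add y q \<in> U)" by (rule small_open_covering_set)
  qed
  from choice[OF this] obtain U where "\<forall>i. open (U i) \<and>
      measure cantor_measure (U i) \<le> 1 / 2 ^ i \<and> (\<forall>y. \<exists>q\<in>Q i. cantor_add y q \<in> U i)" ..
  hence U: "\<And>i. open (U i)" "\<And>i. measure cantor_measure (U i) \<le> 1 / 2 ^ i"
    "\<And>i y. \<exists>q\<in>Q i. cantor_add y q \<in> U i" by auto
  define G where "G n = (\<Union>i\<in>{n..}. U i)" for n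
  have "open (G n)" for n unfolding G_def using U(1) by auto
  moreover have "measure_zero (\<Inter>n. G n)"
  proof -
    have "limsup U \<in> null_sets cantor_measure"
    proof (rule borel_cantelli_limsup1)
      show "U i \<in> sets cantor_measure" for i using U(1) by (rule open_in_sets_cantor_measure)
      show "emeasure cantor_measure (U i) < \<infinity>" for i by (simp add: less_top[symmetric])
      show "summable (\<lambda>i. measure cantor_measure (U i))"
      proof (rule summable_comparison_test'[where N = 0])
        show "summable (\<lambda>i. (1 / 2) ^ i :: real)" by (rule summable_geometric) simp
        show "norm (measure cantor_measure (U i)) \<le> (1 / 2) ^ i" for i
          using U(2)[of i] by (simp add: power_one_over)
      qed
    qed
    moreover have "limsup U = (\<Inter>n. G n)" by (simp add: limsup_INF_SUP G_def)
    ultimately show ?thesis unfolding measure_zero_def by (simp add: null_sets_completionI)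
  qed
  moreover have "\<exists>z\<in>P j \<inter> cyl x k. cantor_add z t \<in> G n" if x: "x \<in> P j" for n t j x k
  proof -
    obtain i where i: "i \<ge> n" "Q i = P j \<inter> cyl x k" using Q(2)[OF x, of n k] by auto
    from U(3)[of i t] obtain q where q: "q \<in> Q i" "cantor_add t q \<in> U i" by auto
    moreover have "cantor_add t q = cantor_add q t" by (auto simp: cantor_add_def)
    ultimately have "cantor_add q t \<in> G n" using i(1) unfolding G_def by auto
    thus ?thesis using q(1) i(2) by (intro bexI[of _ q]) auto
  qed
  ultimately show ?thesis by (intro exI[of _ G] conjI allI ballI)
qed

text \<open>The property shared by strongly meager sets and Sierpinski sets.\<close>
lemma countably_perfectly_meager_if_almost_disjoint_translate:
  assumes "\<And>N. measure_zero N \<Longrightarrow> \<exists>t. countable {a \<in> A. cantor_add a t \<in> N}"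
  shows "countably_perfectly_meager A"
proof (rule countably_perfectly_meagerI)
  fix P :: "nat \<Rightarrow> cantor set"
  assume P: "\<And>j. perfect_set (P j)"
  from translates_dense_null_gdelta[of P, OF P] obtain G :: "nat \<Rightarrow> cantor set" where
    G: "(\<forall>n. open (G n)) \<and> measure_zero (\<Inter>n. G n) \<and>
      (\<forall>n t j. \<forall>x\<in>P j. \<forall>k. \<exists>z\<in>P j \<inter> cyl x k. cantor_add z t \<in> G n)" ..
  note G = G[THEN conjunct1, rule_format] G[THEN conjunct2, THEN conjunct1]
    G[THEN conjunct2, THEN conjunct2, rule_format]
  from assms[OF G(2)] obtain t where t: "countable {a \<in> A. cantor_add a t \<in> (\<Inter>n. G n)}" ..
  define E where "E = {a \<in> A. cantor_add a t \<in> (\<Inter>n. G n)}"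
  define D where "D n = - {y. cantor_add y t \<in> G n}" for n
  define \<C> where "\<C> = range D \<union> (\<lambda>a. {a}) ` E"
  have "countable \<C>" using t unfolding \<C>_def E_def by auto
  moreover have "A \<subseteq> \<Union>\<C>"
  proof
    fix a assume "a \<in> A"
    thus "a \<in> \<Union>\<C>"
      by (cases "a \<in> E") (auto simp: \<C>_def E_def D_def)
  qed
  moreover have "closed C \<and> (\<forall>j. \<forall>x\<in>P j. \<forall>k. \<not> P j \<inter> cyl x k \<subseteq> C)" if C: "C \<in> \<C>" for C
  proof -
    from C consider n where "C = D n" | a where "C = {a}" unfolding \<C>_def by auto
    thus ?thesis
    proof cases
      case (1 n)
      have "closed (D n)" unfolding D_def using open_translate[OF G(1)] by (rule closed_Compl)
      moreover have "\<not> P j \<inter> cyl x k \<subseteq> D n" if "x \<in> P j" for j x k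
        using G(3)[OF that, of k t n] unfolding D_def by auto
      ultimately show ?thesis using 1 by simp
    next
      case (2 a)
      have "\<not> P j \<inter> cyl x k \<subseteq> {a}" if "x \<in> P j" for j x k
        using islimpt_imp_infinite_cantor[OF perfect_set_islimpt[OF P that]] finite_subset by auto
      thus ?thesis using 2 closed_finite_cantor[of "{a}"] by simp
    qed
  qed
  ultimately show "\<exists>\<C>. countable \<C> \<and> A \<subseteq> \<Union>\<C> \<and>
      (\<forall>C\<in>\<C>. closed C \<and> (\<forall>j. \<forall>x\<in>P j. \<forall>k. \<not> P j \<inter> cyl x k \<subseteq> C))"
    by (intro exI[of _ \<C>] conjI ballI) auto
qed

lemma strongly_meager_imp_countably_perfectly_meager:
  assumes "strongly_meager A"
  shows "countably_perfectly_meager A"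
proof (rule countably_perfectly_meager_if_almost_disjoint_translate)
  fix N assume "measure_zero N"
  with assms have "cantor_sumset A N \<noteq> UNIV" unfolding strongly_meager_def by simp
  then obtain t where t: "t \<notin> cantor_sumset A N" by auto
  have "cantor_add a t \<notin> N" if "a \<in> A" for a
  proof
    assume "cantor_add a t \<in> N"
    moreover have "t = cantor_add a (cantor_add a t)" by (auto simp: cantor_add_def)
    ultimately have "t \<in> cantor_sumset A N" using that unfolding cantor_sumset_def by auto
    with t show False ..
  qed
  hence "{a \<in> A. cantor_add a t \<in> N} = {}" by auto
  thus "\<exists>t. countable {a \<in> A. cantor_add a t \<in> N}" by (intro exI[of _ t]) (simp only: countable_empty)
qed

lemma sierpinski_set_imp_countably_perfectly_meager:
  assumes "sierpinski_set A"
  shows "countably_perfectly_meager A"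
proof (rule countably_perfectly_meager_if_almost_disjoint_translate)
  fix N assume "measure_zero N"
  with assms have "countable (A \<inter> N)" unfolding sierpinski_set_def by simp
  moreover have "{a \<in> A. cantor_add a (\<lambda>_. False) \<in> N} = A \<inter> N"
    by (auto simp: cantor_add_def)
  ultimately show "\<exists>t. countable {a \<in> A. cantor_add a t \<in> N}"
    by (intro exI[of _ "\<lambda>_. False"]) simp
qed

section \<open>Meager-additive sets\<close>

text \<open>Every node at level \<^term>\<open>n\<close> of the tree of \<^term>\<open>P\<close> branches before level \<^term>\<open>m\<close>.\<close>
definition splits :: "cantor set \<Rightarrow> nat \<Rightarrow> nat \<Rightarrow> bool"
  where "splits P n m \<longleftrightarrow> (\<forall>x\<in>P. \<exists>z\<in>P \<inter> cyl x n. \<exists>i\<in>{n..<m}. z i \<noteq> x i)"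

lemma splits_mono: "splits P n m \<Longrightarrow> m \<le> m' \<Longrightarrow> splits P n m'"
  unfolding splits_def by fastforce

text \<open>
  The bound \<^term>\<open>m\<close> does not depend on the point because there are only finitely many cylinders of
  level \<^term>\<open>n\<close>: in each one that meets \<^term>\<open>P\<close> fix two different points of
  \<^term>\<open>P\<close>; any third point differs from one of them where these two differ.
\<close>
lemma perfect_set_splits:
  assumes "perfect_set P"
  shows "\<exists>m. splits P n m"
proof -
  have "\<exists>m. P \<inter> cyl s n \<noteq> {} \<longrightarrow> (\<exists>u\<in>P \<inter> cyl s n. \<exists>v\<in>P \<inter> cyl s n. \<exists>i<m. u i \<noteq> v i)" for s
  proof (cases "P \<inter> cyl s n = {}")
    case False
    then obtain u where u: "u \<in> P" "u \<in> cyl s n" by auto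
    have "u islimpt P \<inter> cyl u n" using assms u(1) by (rule perfect_set_islimpt)
    then obtain v where v: "v \<in> P" "v \<in> cyl u n" "v \<noteq> u"
      unfolding islimpt_iff_cyl by auto
    from v(3) obtain i where i: "u i \<noteq> v i" by auto
    have "v \<in> cyl s n" using v(2) u(2) by (simp add: mem_cyl)
    hence differ: "\<exists>v'\<in>P \<inter> cyl s n. \<exists>j<Suc i. u j \<noteq> v' j"
      using v(1) i by (intro bexI[of _ v] exI[of _ i]) auto
    show ?thesis
      by (rule exI[of _ "Suc i"], rule impI, rule bexI[of _ u], rule differ) (use u in simp)
  qed auto
  then obtain m where m: "\<And>s. P \<inter> cyl s n \<noteq> {} \<longrightarrow>
      (\<exists>u\<in>P \<inter> cyl s n. \<exists>v\<in>P \<inter> cyl s n. \<exists>i<m s. u i \<noteq> v i)" by metis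
  define M where "M = Max (insert 0 (m ` level_points n))"
  have "splits P n M"
    unfolding splits_def
  proof
    fix x assume x: "x \<in> P"
    obtain s where s: "s \<in> level_points n" "x \<in> cyl s n" by (rule level_point_in_cyl)
    with x m[of s] obtain u v i where uv: "u \<in> P \<inter> cyl s n" "v \<in> P \<inter> cyl s n" "i < m s" "u i \<noteq> v i"
      by auto
    define z where "z = (if u i \<noteq> x i then u else v)"
    have z: "z \<in> P \<inter> cyl s n" "z i \<noteq> x i" using uv by (auto simp: z_def)
    hence zx: "z \<in> P \<inter> cyl x n" using cyl_eq[OF s(2)] by simp
    have "n \<le> i" using zx z(2) by (auto simp: mem_cyl not_less[symmetric])
    moreover have "m s \<le> M" unfolding M_def using s(1) finite_level_points by (intro Max_ge) auto
    ultimately have "i \<in> {n..<M}" using uv(3) by simp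
    with zx z(2) show "\<exists>z\<in>P \<inter> cyl x n. \<exists>i\<in>{n..<M}. z i \<noteq> x i"
      by (intro bexI[of _ z] bexI[of _ i])
  qed
  thus ?thesis by (rule exI[of _ M])
qed

lemma common_splitting_sequence:
  fixes P :: "nat \<Rightarrow> cantor set"
  assumes "\<And>j. perfect_set (P j)"
  shows "\<exists>f. strict_mono f \<and> (\<forall>k. \<forall>j\<le>k. splits (P j) (f k) (f (Suc k)))"
proof -
  have "\<exists>m. \<forall>j n. splits (P j) n (m j n)" using perfect_set_splits[OF assms] by metis
  then obtain m where m: "\<And>j n. splits (P j) n (m j n)" by auto
  define f where "f = rec_nat 0 (\<lambda>k n. Max (insert (Suc n) ((\<lambda>j. m j n) ` {..k})))"
  have f: "f (Suc k) = Max (insert (Suc (f k)) ((\<lambda>j. m j (f k)) ` {..k}))" for k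
    by (simp add: f_def)
  have "f k < f (Suc k)" for k
  proof -
    have "Suc (f k) \<le> f (Suc k)" unfolding f by (intro Max_ge) auto
    thus ?thesis by simp
  qed
  hence "strict_mono f" by (simp add: strict_mono_Suc_iff)
  moreover have "splits (P j) (f k) (f (Suc k))" if "j \<le> k" for j k
  proof (rule splits_mono[OF m])
    show "m j (f k) \<le> f (Suc k)" unfolding f using that by (intro Max_ge) auto
  qed
  ultimately show ?thesis by (intro exI[of _ f]) auto
qed

lemma nowhere_dense_avoid:
  assumes "nowhere_dense_in euclidean C"
  shows "\<exists>w\<in>cyl z n. \<exists>m\<ge>n. cyl w m \<inter> C = {}"
proof -
  have "\<not> cyl z n \<subseteq> closure C"
  proof
    assume "cyl z n \<subseteq> closure C"
    hence "cyl z n \<subseteq> interior (closure C)" using open_cyl by (rule interior_maximal)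
    hence "z \<in> interior (closure C)" using cyl_refl by (rule subsetD)
    thus False using assms unfolding nowhere_dense_in_def by simp
  qed
  then obtain w where w: "w \<in> cyl z n" "w \<in> - closure C" by auto
  have "open (- closure C)" by (intro open_Compl closed_closure)
  from this w(2) obtain m where m: "cyl w m \<subseteq> - closure C" by (rule cyl_basis)
  have "cyl w (max n m) \<inter> C = {}"
    using m cyl_mono[of m "max n m" w] closure_subset[of C] by auto
  thus ?thesis using w(1) by (intro bexI[of _ w] exI[of _ "max n m"]) auto
qed

text \<open>
  One string \<^term>\<open>y\<close> on \<open>[n, m)\<close> works for all the stems \<^term>\<open>s\<close> and sets \<^term>\<open>C\<close> in
  \<^term>\<open>Z\<close>: the pairs are treated one after another, and each extends the string found so far.
\<close>
lemma avoid_nowhere_dense_uniformly: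
  assumes "finite Z" "\<And>s C. (s, C) \<in> Z \<Longrightarrow> nowhere_dense_in euclidean C"
  shows "\<exists>y m. n \<le> m \<and>
    (\<forall>s C. (s, C) \<in> Z \<longrightarrow> (\<forall>x\<in>cyl s n. (\<forall>i\<in>{n..<m}. x i = y i) \<longrightarrow> x \<notin> C))"
  using assms
proof (induction Z rule: finite_induct)
  case empty
  show ?case by (intro exI[of _ "\<lambda>_. False"] exI[of _ n]) auto
next
  case (insert p Z)
  obtain s C where p: "p = (s, C)" by (cases p)
  have "\<exists>y m. n \<le> m \<and>
      (\<forall>s C. (s, C) \<in> Z \<longrightarrow> (\<forall>x\<in>cyl s n. (\<forall>i\<in>{n..<m}. x i = y i) \<longrightarrow> x \<notin> C))"
  proof (rule insert.IH)
    fix s C assume "(s, C) \<in> Z"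
    thus "nowhere_dense_in euclidean C" using insert.prems[of s C] by simp
  qed
  then obtain y where "\<exists>m. n \<le> m \<and>
      (\<forall>s C. (s, C) \<in> Z \<longrightarrow> (\<forall>x\<in>cyl s n. (\<forall>i\<in>{n..<m}. x i = y i) \<longrightarrow> x \<notin> C))" ..
  then obtain m where ym: "n \<le> m \<and>
      (\<forall>s C. (s, C) \<in> Z \<longrightarrow> (\<forall>x\<in>cyl s n. (\<forall>i\<in>{n..<m}. x i = y i) \<longrightarrow> x \<notin> C))" ..
  note m = ym[THEN conjunct1] and y = ym[THEN conjunct2, rule_format]
  define z where "z = (\<lambda>i. if i < n then s i else y i)"
  have "nowhere_dense_in euclidean C" using insert.prems[of s C] p by simp
  from nowhere_dense_avoid[OF this, of z m] obtain w m' where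
    w: "w \<in> cyl z m" "m' \<ge> m" "cyl w m' \<inter> C = {}" by auto
  have "x \<notin> C'" if "(s', C') \<in> insert p Z" and x: "x \<in> cyl s' n" "\<forall>i\<in>{n..<m'}. x i = w i" for s' C' x
  proof (cases "(s', C') = p")
    case True
    have "x \<in> cyl w m'"
      unfolding mem_cyl
    proof (intro allI impI)
      fix i assume i: "i < m'"
      show "x i = w i"
        using i x w(1) m True p by (cases "i < n") (auto simp: mem_cyl z_def)
    qed
    thus ?thesis using w(3) True p by auto
  next
    case False
    have "x i = y i" if "i \<in> {n..<m}" for i using that x(2) w(1,2) by (auto simp: mem_cyl z_def)
    moreover have "(s', C') \<in> Z" using False that(1) by simp
    ultimately show ?thesis using x(1) by (intro y)
  qed
  moreover have "n \<le> m'" using m w(2) by simp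
  ultimately show ?case by (intro exI[of _ w] exI[of _ m'] conjI allI impI ballI)
qed

text \<open>
  The combinatorial form of meagerness: a point of the union of the \<^term>\<open>C i\<close> agrees with only
  finitely many of the patterns \<^term>\<open>Y n\<close> on their blocks. Block ends can be taken among the
  values of \<^term>\<open>f\<close>, as enlarging a block preserves the property.
\<close>
lemma meager_block_avoidance:
  fixes C :: "nat \<Rightarrow> cantor set" and f :: "nat \<Rightarrow> nat"
  assumes C: "\<And>i. nowhere_dense_in euclidean (C i)" and f: "strict_mono f"
  shows "\<exists>e Y. strict_mono e \<and>
    (\<forall>n x. (\<forall>i\<in>{f (e n)..<f (e (Suc n))}. x i = Y n i) \<longrightarrow> (\<forall>i\<le>n. x \<notin> C i))"
proof -
  define kills where "kills N k k' y \<longleftrightarrow>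
    k < k' \<and> (\<forall>x. (\<forall>i\<in>{f k..<f k'}. x i = y i) \<longrightarrow> (\<forall>i\<le>N. x \<notin> C i))" for N k k' y
  have "\<exists>k' y. kills N k k' y" for N k
  proof -
    define Z where "Z = level_points (f k) \<times> C ` {..N}"
    have "finite Z" unfolding Z_def using finite_level_points by auto
    moreover have "nowhere_dense_in euclidean D" if "(s, D) \<in> Z" for s D
      using that C by (auto simp: Z_def)
    ultimately have "\<exists>y m. f k \<le> m \<and>
        (\<forall>s D. (s, D) \<in> Z \<longrightarrow> (\<forall>x\<in>cyl s (f k). (\<forall>i\<in>{f k..<m}. x i = y i) \<longrightarrow> x \<notin> D))"
      by (rule avoid_nowhere_dense_uniformly)
    then obtain y where "\<exists>m. f k \<le> m \<and>
        (\<forall>s D. (s, D) \<in> Z \<longrightarrow> (\<forall>x\<in>cyl s (f k). (\<forall>i\<in>{f k..<m}. x i = y i) \<longrightarrow> x \<notin> D))" ..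
    then obtain m where ym: "f k \<le> m \<and>
        (\<forall>s D. (s, D) \<in> Z \<longrightarrow> (\<forall>x\<in>cyl s (f k). (\<forall>i\<in>{f k..<m}. x i = y i) \<longrightarrow> x \<notin> D))" ..
    note y = ym[THEN conjunct2, rule_format]
    define k' where "k' = max m (Suc k)"
    have "m \<le> f k'" using strict_mono_imp_increasing[OF f, of k'] by (simp add: k'_def)
    have "x \<notin> C i" if x: "\<forall>i\<in>{f k..<f k'}. x i = y i" and i: "i \<le> N" for x i
    proof -
      obtain s where s: "s \<in> level_points (f k)" "x \<in> cyl s (f k)" by (rule level_point_in_cyl)
      have "(s, C i) \<in> Z" using s(1) i by (auto simp: Z_def)
      moreover have "x i = y i" if "i \<in> {f k..<m}" for i using that x \<open>m \<le> f k'\<close> by auto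
      ultimately show ?thesis using s(2) by (intro y)
    qed
    hence "kills N k k' y" unfolding kills_def by (simp add: k'_def)
    thus ?thesis by (intro exI[of _ k'] exI[of _ y])
  qed
  hence "\<exists>E Y. \<forall>N k. kills N k (E N k) (Y N k)" by metis
  then obtain E Y where kills: "\<And>N k. kills N k (E N k) (Y N k)" by auto
  have E: "k < E N k" for N k using kills[of N k] unfolding kills_def by simp
  have Y: "(\<forall>i\<in>{f k..<f (E N k)}. x i = Y N k i) \<longrightarrow> (\<forall>i\<le>N. x \<notin> C i)" for N k x
    using kills[of N k] unfolding kills_def by simp
  define e where "e = rec_nat 0 E"
  have e: "e (Suc n) = E n (e n)" for n by (simp add: e_def)
  have "strict_mono e" using E by (simp add: strict_mono_Suc_iff e)
  moreover have "\<forall>n x. (\<forall>i\<in>{f (e n)..<f (e (Suc n))}. x i = Y n (e n) i) \<longrightarrow> (\<forall>i\<le>n. x \<notin> C i)"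
    unfolding e using Y by simp
  ultimately show ?thesis by (intro exI[of _ e] exI[of _ "\<lambda>n. Y n (e n)"] conjI)
qed

lemma meager_eventually_nonzero_blocks:
  fixes f :: "nat \<Rightarrow> nat"
  assumes f: "strict_mono f"
  shows "meager_in euclidean {x :: cantor. \<exists>K. \<forall>k\<ge>K. \<exists>i\<in>{f k..<f (Suc k)}. x i}"
  unfolding meager_in_def
proof (intro exI conjI allI)
  fix K :: nat
  let ?C = "{x::cantor. \<forall>k\<ge>K. \<exists>i\<in>{f k..<f (Suc k)}. x i}"
  have "closed ?C"
    unfolding closed_def open_iff_cyl
  proof
    fix x assume "x \<in> - ?C"
    then obtain k where k: "k \<ge> K" "\<forall>i\<in>{f k..<f (Suc k)}. \<not> x i" by auto
    have "cyl x (f (Suc k)) \<subseteq> - ?C"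
    proof
      fix y assume "y \<in> cyl x (f (Suc k))"
      hence "\<forall>i\<in>{f k..<f (Suc k)}. \<not> y i" using k(2) by (auto simp: mem_cyl)
      thus "y \<in> - ?C" using k(1) by auto
    qed
    thus "\<exists>n. cyl x n \<subseteq> - ?C" by (rule exI[of _ "f (Suc k)"])
  qed
  moreover have "\<not> UNIV \<inter> cyl x n \<subseteq> ?C" for x n
  proof
    assume *: "UNIV \<inter> cyl x n \<subseteq> ?C"
    define y where "y i = (i < n \<and> x i)" for i
    have "y \<in> cyl x n" by (simp add: mem_cyl y_def)
    moreover from * have "cyl x n \<subseteq> ?C" by simp
    ultimately have "y \<in> ?C" by (rule subsetD[rotated])
    hence "\<exists>i\<in>{f (max K n)..<f (Suc (max K n))}. y i" by simp
    then obtain i where "i \<in> {f (max K n)..<f (Suc (max K n))}" "y i" by (rule bexE)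
    moreover have "max K n \<le> f (max K n)" using f by (rule strict_mono_imp_increasing)
    ultimately show False by (auto simp: y_def)
  qed
  ultimately have "nowhere_dense_in (top_of_set UNIV) (?C \<inter> UNIV)"
    by (intro nowhere_dense_in_subspace)
  thus "nowhere_dense_in euclidean ?C" by simp
qed auto

text \<open>
  If \<^term>\<open>a\<close> disagreed with \<^term>\<open>Y n\<close> on every interval of the \<^term>\<open>n\<close>-th block for
  infinitely many (\<open>bad\<close>) \<^term>\<open>n\<close>, let \<^term>\<open>z\<close> be \<open>a + Y n\<close> on the bad blocks and \<open>1\<close> elsewhere.
  Then \<^term>\<open>z\<close> vanishes on no interval, so \<open>a + z\<close> belongs to the meager set \<open>A + M\<close>; but
  \<open>a + z\<close> equals \<^term>\<open>Y n\<close> on infinitely many blocks, which excludes it from that set.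
\<close>
lemma meager_additive_block_matching:
  fixes f :: "nat \<Rightarrow> nat"
  assumes A: "meager_additive A" and f: "strict_mono f"
  shows "\<exists>e Y. strict_mono e \<and>
    (\<forall>a\<in>A. \<exists>K. \<forall>n\<ge>K. \<exists>k\<in>{e n..<e (Suc n)}. \<forall>i\<in>{f k..<f (Suc k)}. a i = Y n i)"
proof -
  define M where "M = {x :: cantor. \<exists>K. \<forall>k\<ge>K. \<exists>i\<in>{f k..<f (Suc k)}. x i}"
  have "meager_in euclidean M"
    unfolding M_def using f by (rule meager_eventually_nonzero_blocks)
  with A have "meager_in euclidean (cantor_sumset A M)" unfolding meager_additive_def by simp
  then obtain C where "(\<forall>i. nowhere_dense_in euclidean (C i)) \<and> cantor_sumset A M = (\<Union>i::nat. C i)"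
    unfolding meager_in_def ..
  hence C: "\<And>i. nowhere_dense_in euclidean (C i)" "cantor_sumset A M = (\<Union>i. C i)" by auto
  from meager_block_avoidance[of C f, OF C(1) f] obtain e Y where eY: "strict_mono e \<and>
    (\<forall>n x. (\<forall>i\<in>{f (e n)..<f (e (Suc n))}. x i = Y n i) \<longrightarrow> (\<forall>i\<le>n. x \<notin> C i))" by auto
  note e = eY[THEN conjunct1] and Y = eY[THEN conjunct2, rule_format]
  have block_unique: "n = n'" if "e n \<le> k" "k < e (Suc n)" "e n' \<le> k" "k < e (Suc n')" for n n' k
  proof -
    have "n < Suc n'" "n' < Suc n"
      using that strict_mono_less[OF e, of n "Suc n'"] strict_mono_less[OF e, of n' "Suc n"] by auto
    thus ?thesis by simp
  qed
  have "\<exists>K. \<forall>n\<ge>K. \<exists>k\<in>{e n..<e (Suc n)}. \<forall>i\<in>{f k..<f (Suc k)}. a i = Y n i" if a: "a \<in> A" for a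
  proof (rule ccontr)
    define bad where "bad n \<longleftrightarrow> (\<forall>k\<in>{e n..<e (Suc n)}. \<exists>i\<in>{f k..<f (Suc k)}. a i \<noteq> Y n i)" for n
    assume "\<not> ?thesis"
    hence bad: "\<exists>n\<ge>K. bad n" for K by (auto simp: bad_def)
    define z where "z i = (\<forall>n. bad n \<longrightarrow> i \<in> {f (e n)..<f (e (Suc n))} \<longrightarrow> a i \<noteq> Y n i)" for i
    have z_block: "z i \<longleftrightarrow> a i \<noteq> Y n i"
      if "bad n" "k \<in> {e n..<e (Suc n)}" "i \<in> {f k..<f (Suc k)}" for n k i
    proof -
      have in_block: "i \<in> {f (e l)..<f (e (Suc l))} \<longleftrightarrow> k \<in> {e l..<e (Suc l)}" for l
      proof
        assume "i \<in> {f (e l)..<f (e (Suc l))}"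
        with that(3) have "f (e l) < f (Suc k)" "f k < f (e (Suc l))" by auto
        thus "k \<in> {e l..<e (Suc l)}" using strict_mono_less[OF f] by auto
      next
        assume "k \<in> {e l..<e (Suc l)}"
        hence "f (e l) \<le> f k" "f (Suc k) \<le> f (e (Suc l))"
          using strict_mono_less_eq[OF f] by auto
        thus "i \<in> {f (e l)..<f (e (Suc l))}" using that(3) by auto
      qed
      have "l = n" if "k \<in> {e l..<e (Suc l)}" for l
        using block_unique[of l k n] that \<open>k \<in> {e n..<e (Suc n)}\<close> by auto
      hence "z i" if "a i \<noteq> Y n i"
        unfolding z_def in_block using that by (intro allI impI) simp
      moreover have "a i \<noteq> Y n i" if "z i"
        using that[unfolded z_def in_block, rule_format, of n] \<open>bad n\<close> \<open>k \<in> {e n..<e (Suc n)}\<close>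
        by simp
      ultimately show ?thesis by (rule iffI[rotated])
    qed
    have "\<exists>i\<in>{f k..<f (Suc k)}. z i" for k
    proof (cases "\<exists>n. bad n \<and> k \<in> {e n..<e (Suc n)}")
      case True
      then obtain n where n: "bad n" "k \<in> {e n..<e (Suc n)}" by auto
      from n(1)[unfolded bad_def] n(2) have "\<exists>i\<in>{f k..<f (Suc k)}. a i \<noteq> Y n i" by (rule bspec)
      then obtain i where "i \<in> {f k..<f (Suc k)}" "a i \<noteq> Y n i" by (rule bexE)
      thus ?thesis using z_block[OF n] by (intro bexI[of _ i]) auto
    next
      case False
      have "z (f k)"
        unfolding z_def
      proof (intro allI impI)
        fix n assume "bad n" "f k \<in> {f (e n)..<f (e (Suc n))}"
        hence "k \<in> {e n..<e (Suc n)}"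
          using strict_mono_less[OF f] strict_mono_less_eq[OF f] by auto
        with False \<open>bad n\<close> show "a (f k) \<noteq> Y n (f k)" by auto
      qed
      moreover have "f k < f (Suc k)" using f by (simp add: strict_mono_Suc_iff)
      ultimately show ?thesis by (intro bexI[of _ "f k"]) auto
    qed
    hence "z \<in> M" unfolding M_def by auto
    hence "cantor_add a z \<in> cantor_sumset A M" using a unfolding cantor_sumset_def by auto
    then obtain l where l: "cantor_add a z \<in> C l" unfolding C(2) by auto
    obtain n where n: "n \<ge> l" "bad n" using bad[of l] by auto
    have "cantor_add a z i = Y n i" if i: "i \<in> {f (e n)..<f (e (Suc n))}" for i
    proof -
      have "z i \<longleftrightarrow> a i \<noteq> Y n i"
      proof -
        obtain k where k: "f k \<le> i" "i < f (Suc k)" "e n \<le> k" "k < e (Suc n)"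
        proof -
          define k where "k = (LEAST k. i < f (Suc k))"
          have "i < f (Suc i)" using strict_mono_imp_increasing[OF f, of "Suc i"] by simp
          hence 1: "i < f (Suc k)" unfolding k_def by (rule LeastI)
          have 2: "f k \<le> i"
          proof (cases k)
            case (Suc k')
            hence "\<not> i < f (Suc k')" using not_less_Least[of k' "\<lambda>k. i < f (Suc k)"] k_def by simp
            thus ?thesis using Suc by simp
          next
            case 0
            have "f 0 \<le> f (e n)" using strict_mono_less_eq[OF f] by simp
            thus ?thesis using 0 i by simp
          qed
          have "f (e n) < f (Suc k)" "f k < f (e (Suc n))" using i 1 2 by auto
          hence "e n \<le> k" "k < e (Suc n)" using strict_mono_less[OF f] by auto
          with 1 2 show thesis by (intro that)
        qed
        thus ?thesis using z_block[OF n(2), of k i] by simp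
      qed
      thus ?thesis unfolding cantor_add_def by auto
    qed
    hence "cantor_add a z \<notin> C l" using Y[of n "cantor_add a z" l] n(1) by auto
    with l show False by simp
  qed
  with e show ?thesis by (intro exI[of _ e] exI[of _ Y] conjI ballI)
qed

text \<open>
  Walk through the intervals from level \<open>f K\<close> on. In each of them the tree of \<^term>\<open>P\<close> offers two
  continuations that differ at some coordinate, so one of them disagrees with \<^term>\<open>y\<close> there.
\<close>
lemma splitting_mismatch:
  assumes "\<And>k. K \<le> k \<Longrightarrow> splits P (f k) (f (Suc k))" "x \<in> P" "K \<le> L" "strict_mono f"
  shows "\<exists>w\<in>P \<inter> cyl x (f K). \<forall>k\<in>{K..<L}. \<exists>i\<in>{f k..<f (Suc k)}. w i \<noteq> y i"
  using assms(3)
proof (induction L rule: dec_induct)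
  case base
  show ?case using assms(2) by (intro bexI[of _ x]) auto
next
  case (step L)
  from step.IH obtain w where w: "w \<in> P" "w \<in> cyl x (f K)"
    "\<forall>k\<in>{K..<L}. \<exists>i\<in>{f k..<f (Suc k)}. w i \<noteq> y i" by auto
  from assms(1)[OF step(1), unfolded splits_def] w(1)
  have "\<exists>z\<in>P \<inter> cyl w (f L). \<exists>i\<in>{f L..<f (Suc L)}. z i \<noteq> w i" by (rule bspec)
  then obtain z where z: "z \<in> P \<inter> cyl w (f L)"
    and "\<exists>i\<in>{f L..<f (Suc L)}. z i \<noteq> w i" by (rule bexE)
  from this(2) obtain i where i: "i \<in> {f L..<f (Suc L)}" "z i \<noteq> w i" by (rule bexE)
  define v where "v = (if w i \<noteq> y i then w else z)"
  have v: "v \<in> P" "v \<in> cyl w (f L)" "v i \<noteq> y i" using w(1) z i(2) by (auto simp: v_def)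
  have "f K \<le> f L" using step(1) strict_mono_less_eq[OF assms(4)] by simp
  hence "v \<in> P \<inter> cyl x (f K)" using v(1,2) w(2) by (auto simp: mem_cyl)
  moreover have "\<exists>j\<in>{f k..<f (Suc k)}. v j \<noteq> y j" if k: "k \<in> {K..<Suc L}" for k
  proof (cases "k = L")
    case True
    thus ?thesis using i(1) v(3) by auto
  next
    case False
    with k have "k \<in> {K..<L}" by auto
    with w(3) have "\<exists>j\<in>{f k..<f (Suc k)}. w j \<noteq> y j" by (rule bspec)
    then obtain j where j: "j \<in> {f k..<f (Suc k)}" "w j \<noteq> y j" by (rule bexE)
    have "f (Suc k) \<le> f L" using \<open>k \<in> {K..<L}\<close> strict_mono_less_eq[OF assms(4)] by simp
    hence "v j = w j" using v(2) j(1) by (auto simp: mem_cyl)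
    thus ?thesis using j by (intro bexI[of _ j]) auto
  qed
  ultimately show ?case by (intro bexI[of _ v] ballI)
qed

lemma meager_additive_imp_countably_perfectly_meager:
  assumes "meager_additive A"
  shows "countably_perfectly_meager A"
proof (rule countably_perfectly_meagerI)
  fix P :: "nat \<Rightarrow> cantor set"
  assume P: "\<And>j. perfect_set (P j)"
  from common_splitting_sequence[of P, OF P] obtain f where
    f: "strict_mono f" "\<And>k j. j \<le> k \<Longrightarrow> splits (P j) (f k) (f (Suc k))" by auto
  from meager_additive_block_matching[OF assms f(1)] obtain e Y where eY: "strict_mono e \<and>
    (\<forall>a\<in>A. \<exists>K. \<forall>n\<ge>K. \<exists>k\<in>{e n..<e (Suc n)}. \<forall>i\<in>{f k..<f (Suc k)}. a i = Y n i)" by auto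
  note e = eY[THEN conjunct1] and Y = eY[THEN conjunct2]
  define C where "C K = {x. \<forall>n\<ge>K. \<exists>k\<in>{e n..<e (Suc n)}. \<forall>i\<in>{f k..<f (Suc k)}. x i = Y n i}"
    for K :: nat
  have "closed (C K)" for K
    unfolding closed_def open_iff_cyl
  proof
    fix x assume "x \<in> - C K"
    then obtain n where n: "n \<ge> K"
      "\<forall>k\<in>{e n..<e (Suc n)}. \<exists>i\<in>{f k..<f (Suc k)}. x i \<noteq> Y n i" unfolding C_def by auto
    have "cyl x (f (e (Suc n))) \<subseteq> - C K"
    proof
      fix y assume y: "y \<in> cyl x (f (e (Suc n)))"
      have "\<exists>i\<in>{f k..<f (Suc k)}. y i \<noteq> Y n i" if k: "k \<in> {e n..<e (Suc n)}" for k
      proof -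
        from n(2) k have "\<exists>i\<in>{f k..<f (Suc k)}. x i \<noteq> Y n i" by (rule bspec)
        then obtain i where i: "i \<in> {f k..<f (Suc k)}" "x i \<noteq> Y n i" by (rule bexE)
        have "f (Suc k) \<le> f (e (Suc n))" using k strict_mono_less_eq[OF f(1)] by simp
        hence "y i = x i" using y i(1) by (auto simp: mem_cyl)
        thus ?thesis using i by (intro bexI[of _ i]) auto
      qed
      thus "y \<in> - C K" using n(1) unfolding C_def by auto
    qed
    thus "\<exists>n. cyl x n \<subseteq> - C K" by (rule exI[of _ "f (e (Suc n))"])
  qed
  moreover have "\<not> P j \<inter> cyl x l \<subseteq> C K" if x: "x \<in> P j" for j x l K
  proof
    assume sub: "P j \<inter> cyl x l \<subseteq> C K"
    define n where "n = max K (max j l)"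
    have n: "K \<le> n" "j \<le> n" "l \<le> n" by (auto simp: n_def)
    have "n \<le> e n" using e by (rule strict_mono_imp_increasing)
    moreover have "e n \<le> f (e n)" using f(1) by (rule strict_mono_imp_increasing)
    ultimately have en: "j \<le> e n" "l \<le> f (e n)" using n by auto
    have "e n \<le> e (Suc n)" using strict_mono_less_eq[OF e] by simp
    moreover have "splits (P j) (f k) (f (Suc k))" if "e n \<le> k" for k using f(2) en(1) that by simp
    ultimately obtain w where w: "w \<in> P j \<inter> cyl x (f (e n))"
      "\<forall>k\<in>{e n..<e (Suc n)}. \<exists>i\<in>{f k..<f (Suc k)}. w i \<noteq> Y n i"
      using splitting_mismatch[of "e n" "P j" f x "e (Suc n)" "Y n"] x f(1) by auto
    have "w \<in> P j \<inter> cyl x l" using w(1) cyl_mono[OF en(2)] by auto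
    with sub have "w \<in> C K" by (rule subsetD)
    with n(1) have "\<exists>k\<in>{e n..<e (Suc n)}. \<forall>i\<in>{f k..<f (Suc k)}. w i = Y n i"
      unfolding C_def by simp
    then obtain k where k: "k \<in> {e n..<e (Suc n)}" "\<forall>i\<in>{f k..<f (Suc k)}. w i = Y n i"
      by (rule bexE)
    from w(2) k(1) have "\<exists>i\<in>{f k..<f (Suc k)}. w i \<noteq> Y n i" by (rule bspec)
    with k(2) show False by simp
  qed
  moreover have "A \<subseteq> \<Union>(range C)" using Y unfolding C_def by auto
  ultimately show "\<exists>\<C>. countable \<C> \<and> A \<subseteq> \<Union>\<C> \<and>
      (\<forall>C\<in>\<C>. closed C \<and> (\<forall>j. \<forall>x\<in>P j. \<forall>k. \<not> P j \<inter> cyl x k \<subseteq> C))"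
    by (intro exI[of _ "range C"]) auto
qed

theorem corollary2p9:
  fixes A :: "cantor set"
  assumes "meager_additive A \<or> gamma_set A \<or> strongly_meager A \<or> sierpinski_set A"
  shows "countably_perfectly_meager A"
  using assms meager_additive_imp_countably_perfectly_meager
    gamma_set_imp_countably_perfectly_meager strongly_meager_imp_countably_perfectly_meager
    sierpinski_set_imp_countably_perfectly_meager by auto

end
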